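(* Let $T$ be a nonempty set, $F(T)$ an algebra of real functions defined on $T$, and $L\subseteq F(T)$ a subclass closed under addition and under multiplication by real scalars. Let $f,g,h\in F(T)$ with $h\ge 0$ and $h\in L$ be such that $fgh\in L$, $f^2h\in L$ and $g^2h\in L$. If $m,M$ are real numbers such that $$m\,g(t)\le f(t)\le M\,g(t)\quad\text{for all } t\in T,$$ then for any isotonic linear functional $A:L\to\mathbb{R}$ with $A(h)>0$ one has $$0\le A(hf^2)\,A(hg^2)-[A(hfg)]^2\le \frac14 (M-m)^2\,[A(hg^2)]^2 .$$ The constant $\frac14$ is sharp, in the sense that there is no constant $C<\frac14$ for which the right-hand inequality, with $\frac14$ replaced by $C$, holds for all nonempty sets $T$, all algebras $F(T)$ of real functions on $T$, all subclasses $L\subseteq F(T)$ closed under addition and under multiplication by real scalars, all $f,g,h\in F(T)$ with $h\ge 0$, $h\in L$ and $fgh,f^2h,g^2h\in L$, all real numbers $m,M$ with $m\,g(t)\le f(t)\le M\,g(t)$ for all $t\in T$, and all isotonic linear functionals $A:L\to\mathbb{R}$ with $A(h)>0$.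
   Context: A functional $A:L\to\mathbb{R}$ is an isotonic linear functional on $L$ if (a) $A(\alpha f+\beta g)=\alpha A(f)+\beta A(g)$ for all $\alpha,\beta\in\mathbb{R}$ and $f,g\in L$; and (b) $f\ge g$ (i.e. $f(t)\ge g(t)$ for all $t\in T$), $f,g\in L$, implies $A(f)\ge A(g)$. Products of functions are pointwise. *)

theory Defs
  imports Complex_Main "HOL-Library.FuncSet"
begin

text \<open>
  A real function on a set \<open>T\<close> is an element of \<open>T \<rightarrow>\<^sub>E UNIV\<close>, so that two of them are equal
  iff they agree on \<open>T\<close>. All operations are pointwise on \<open>T\<close>.
\<close>

definition closed_add :: "'a set \<Rightarrow> ('a \<Rightarrow> real) set \<Rightarrow> bool" where
  "closed_add T S \<longleftrightarrow> (\<forall>f\<in>S. \<forall>g\<in>S. (\<lambda>t\<in>T. f t + g t) \<in> S)"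

definition closed_scale :: "'a set \<Rightarrow> ('a \<Rightarrow> real) set \<Rightarrow> bool" where
  "closed_scale T S \<longleftrightarrow> (\<forall>c::real. \<forall>f\<in>S. (\<lambda>t\<in>T. c * f t) \<in> S)"

definition closed_mult :: "'a set \<Rightarrow> ('a \<Rightarrow> real) set \<Rightarrow> bool" where
  "closed_mult T S \<longleftrightarrow> (\<forall>f\<in>S. \<forall>g\<in>S. (\<lambda>t\<in>T. f t * g t) \<in> S)"

text \<open>An algebra need not contain the constant function 1.\<close>

definition function_algebra :: "'a set \<Rightarrow> ('a \<Rightarrow> real) set \<Rightarrow> bool" where
  "function_algebra T F \<longleftrightarrow>
     F \<subseteq> (T \<rightarrow>\<^sub>E UNIV) \<and> (\<lambda>t\<in>T. 0) \<in> F \<and>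
     closed_add T F \<and> closed_scale T F \<and> closed_mult T F"

text \<open>The functional is a total HOL function; only its values on \<open>L\<close> matter.\<close>

definition isotonic_linear_functional ::
    "'a set \<Rightarrow> ('a \<Rightarrow> real) set \<Rightarrow> (('a \<Rightarrow> real) \<Rightarrow> real) \<Rightarrow> bool" where
  "isotonic_linear_functional T L A \<longleftrightarrow>
     (\<forall>\<alpha> \<beta>. \<forall>f\<in>L. \<forall>g\<in>L. A (\<lambda>t\<in>T. \<alpha> * f t + \<beta> * g t) = \<alpha> * A f + \<beta> * A g) \<and>
     (\<forall>f\<in>L. \<forall>g\<in>L. (\<forall>t\<in>T. f t \<ge> g t) \<longrightarrow> A f \<ge> A g)"

definition admissible ::
    "'a set \<Rightarrow> ('a \<Rightarrow> real) set \<Rightarrow> ('a \<Rightarrow> real) set \<Rightarrow> ('a \<Rightarrow> real) \<Rightarrow> ('a \<Rightarrow> real) \<Rightarrow> ('a \<Rightarrow> real) \<Rightarrow>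
     real \<Rightarrow> real \<Rightarrow> (('a \<Rightarrow> real) \<Rightarrow> real) \<Rightarrow> bool" where
  "admissible T F L f g h m M A \<longleftrightarrow>
     T \<noteq> {} \<and> function_algebra T F \<and>
     L \<subseteq> F \<and> closed_add T L \<and> closed_scale T L \<and>
     f \<in> F \<and> g \<in> F \<and> h \<in> F \<and> (\<forall>t\<in>T. h t \<ge> 0) \<and> h \<in> L \<and>
     (\<lambda>t\<in>T. f t * g t * h t) \<in> L \<and> (\<lambda>t\<in>T. (f t)\<^sup>2 * h t) \<in> L \<and> (\<lambda>t\<in>T. (g t)\<^sup>2 * h t) \<in> L \<and>
     (\<forall>t\<in>T. m * g t \<le> f t \<and> f t \<le> M * g t) \<and>
     isotonic_linear_functional T L A \<and> A h > 0"

end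

theory Submission
  imports Defs
begin

text \<open>
  Write \<open>X = A (h f\<^sup>2)\<close>, \<open>Y = A (h g\<^sup>2)\<close>, \<open>P = A (h f g)\<close>. Since \<open>h (a f + b g)\<^sup>2 \<ge> 0\<close>, the
  quadratic form \<open>a\<^sup>2 X + 2 a b P + b\<^sup>2 Y\<close> is nonnegative, which is the lower bound. Since
  \<open>h (f - m g) (M g - f) \<ge> 0\<close>, one has \<open>X \<le> (m + M) P - m M Y\<close>; multiplying by \<open>Y \<ge> 0\<close> and completing
  the square gives the upper bound. It is attained for \<open>f = (1, -1)\<close>, \<open>g = h = 1\<close> and the sum
  functional on a two-point set.
\<close>

text \<open>Carries pointwise inequalities over to values of \<open>A\<close>: the combination is
  built by two binary ones inside \<open>L\<close> and compared with the zero function by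
  isotonicity.\<close>

lemma isotonic_linear_functional_comb3_nonneg:
  assumes A: "isotonic_linear_functional T L A"
    and add: "closed_add T L" and scale: "closed_scale T L"
    and L: "u \<in> L" "v \<in> L" "w \<in> L"
    and nonneg: "\<And>t. t \<in> T \<Longrightarrow> 0 \<le> a * u t + b * v t + c * w t"
  shows "0 \<le> a * A u + b * A v + c * A w"
proof -
  have lin: "A (\<lambda>t\<in>T. \<alpha> * p t + \<beta> * q t) = \<alpha> * A p + \<beta> * A q"
    if "p \<in> L" "q \<in> L" for \<alpha> \<beta> p q
    using A that unfolding isotonic_linear_functional_def by blast
  have comb: "(\<lambda>t\<in>T. \<alpha> * p t + \<beta> * q t) \<in> L" if "p \<in> L" "q \<in> L" for \<alpha> \<beta> p q
  proof -
    have "(\<lambda>t\<in>T. \<alpha> * p t) \<in> L" "(\<lambda>t\<in>T. \<beta> * q t) \<in> L"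
      using scale that unfolding closed_scale_def by blast+
    then have "(\<lambda>t\<in>T. (\<lambda>t\<in>T. \<alpha> * p t) t + (\<lambda>t\<in>T. \<beta> * q t) t) \<in> L"
      using add unfolding closed_add_def by blast
    then show ?thesis by (simp cong: restrict_cong)
  qed
  \<comment> \<open>The zero function, written as a combination so that \<open>comb\<close> and
    \<open>lin\<close> give both \<open>z \<in> L\<close> and \<open>A z = 0\<close>.\<close>
  define z where "z = (\<lambda>t\<in>T. 0 * u t + 0 * u t)"
  define p where "p = (\<lambda>t\<in>T. a * u t + b * v t)"
  define q where "q = (\<lambda>t\<in>T. 1 * p t + c * w t)"
  have mem: "z \<in> L" "p \<in> L" "q \<in> L"
    unfolding z_def q_def p_def by (intro comb L)+
  have "\<forall>t\<in>T. z t \<le> q t"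
    using nonneg by (simp add: z_def q_def p_def)
  then have "A z \<le> A q"
    using A mem unfolding isotonic_linear_functional_def by blast
  moreover have "A z = 0" unfolding z_def using lin[of u u 0 0] L by simp
  moreover have "A p = a * A u + b * A v" unfolding p_def by (intro lin L)
  moreover have "A q = 1 * A p + c * A w" unfolding q_def by (intro lin L mem)
  ultimately show ?thesis by simp
qed

text \<open>Discriminant argument, with the degenerate case \<open>Y = 0\<close> treated
  apart.\<close>

lemma square_le_of_nonneg_quadratic_form:
  fixes X Y P :: real
  assumes form: "\<And>a b. 0 \<le> a\<^sup>2 * X + 2 * a * b * P + b\<^sup>2 * Y"
  shows "P\<^sup>2 \<le> X * Y"
proof -
  have X: "0 \<le> X" and Y: "0 \<le> Y"
    using form[of 1 0] form[of 0 1] by simp_all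
  show ?thesis
  proof (cases "Y = 0")
    case True
    \<comment> \<open>For \<open>Y = 0\<close>, this \<open>b\<close> makes the cross term
      \<open>- 2 * P\<^sup>2 * (X + 1)\<close> outweigh \<open>P\<^sup>2 * X\<close>, which forces
      \<open>P = 0\<close>.\<close>
    have "0 \<le> - (P\<^sup>2 * (X + 2))"
      using form[of P "- (X + 1)"] True by (simp add: algebra_simps power2_eq_square)
    then have "P = 0"
      using X by (simp add: mult_le_0_iff)
    then show ?thesis using True by simp
  next
    case False
    \<comment> \<open>For fixed \<open>a\<close> and \<open>Y > 0\<close> the form is minimal at
      \<open>b = - a * P / Y\<close>; taking \<open>a = Y\<close> clears the denominator.\<close>
    have "0 \<le> Y * (X * Y - P\<^sup>2)"
      using form[of Y "- P"] by (simp add: algebra_simps power2_eq_square)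
    then show ?thesis using False Y by (simp add: zero_le_mult_iff)
  qed
qed

lemma product_minus_square_le:
  fixes X Y P m M :: real
  assumes "0 \<le> Y" and "X \<le> (m + M) * P - m * M * Y"
  shows "X * Y - P\<^sup>2 \<le> 1 / 4 * (M - m)\<^sup>2 * Y\<^sup>2"
proof -
  have "X * Y - P\<^sup>2 \<le> ((m + M) * P - m * M * Y) * Y - P\<^sup>2"
    using assms by (simp add: mult_right_mono)
  also have "\<dots> = 1 / 4 * (M - m)\<^sup>2 * Y\<^sup>2 - (P - (m + M) / 2 * Y)\<^sup>2"
    by (simp add: field_simps power2_eq_square)
  also have "\<dots> \<le> 1 / 4 * (M - m)\<^sup>2 * Y\<^sup>2" by simp
  finally show ?thesis .
qed

lemma admissible_bounds:
  assumes "admissible T F L f g h m M A"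
  defines "X \<equiv> A (\<lambda>t\<in>T. h t * (f t)\<^sup>2)"
    and "Y \<equiv> A (\<lambda>t\<in>T. h t * (g t)\<^sup>2)"
    and "P \<equiv> A (\<lambda>t\<in>T. h t * f t * g t)"
  shows "0 \<le> X * Y - P\<^sup>2" "X * Y - P\<^sup>2 \<le> 1 / 4 * (M - m)\<^sup>2 * Y\<^sup>2"
proof -
  have A: "isotonic_linear_functional T L A" "closed_add T L" "closed_scale T L"
    and h: "\<And>t. t \<in> T \<Longrightarrow> 0 \<le> h t"
    and fg: "\<And>t. t \<in> T \<Longrightarrow> m * g t \<le> f t" "\<And>t. t \<in> T \<Longrightarrow> f t \<le> M * g t"
    and L: "(\<lambda>t\<in>T. h t * (f t)\<^sup>2) \<in> L" "(\<lambda>t\<in>T. h t * f t * g t) \<in> L"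
      "(\<lambda>t\<in>T. h t * (g t)\<^sup>2) \<in> L"
    using assms(1) unfolding admissible_def by (simp_all add: mult_ac)
  \<comment> \<open>Both bounds reduce to a quadratic form in \<open>f t\<close> and
    \<open>g t\<close>, since the weight \<open>h t\<close> is nonnegative.\<close>
  have nonneg: "0 \<le> a * X + b * P + c * Y"
    if "\<And>t. t \<in> T \<Longrightarrow> 0 \<le> a * (f t)\<^sup>2 + b * (f t * g t) + c * (g t)\<^sup>2" for a b c
    unfolding X_def P_def Y_def
  proof (rule isotonic_linear_functional_comb3_nonneg[OF A L])
    fix t assume t: "t \<in> T"
    have "0 \<le> h t * (a * (f t)\<^sup>2 + b * (f t * g t) + c * (g t)\<^sup>2)"
      using h[OF t] that[OF t] by simp
    then show "0 \<le> a * (\<lambda>t\<in>T. h t * (f t)\<^sup>2) t + b * (\<lambda>t\<in>T. h t * f t * g t) t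
        + c * (\<lambda>t\<in>T. h t * (g t)\<^sup>2) t"
      using t by (simp add: algebra_simps)
  qed
  have form: "0 \<le> a\<^sup>2 * X + 2 * a * b * P + b\<^sup>2 * Y" for a b
  proof (rule nonneg)
    fix t
    have "0 \<le> (a * f t + b * g t)\<^sup>2" by simp
    then show "0 \<le> a\<^sup>2 * (f t)\<^sup>2 + 2 * a * b * (f t * g t) + b\<^sup>2 * (g t)\<^sup>2"
      by (simp add: power2_eq_square algebra_simps)
  qed
  then show "0 \<le> X * Y - P\<^sup>2"
    using square_le_of_nonneg_quadratic_form by simp
  have "0 \<le> (- 1) * X + (m + M) * P + (- (m * M)) * Y"
  proof (rule nonneg)
    fix t assume t: "t \<in> T"
    \<comment> \<open>Both factors are nonnegative, whatever the sign of \<open>g t\<close>.\<close>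
    have "0 \<le> (f t - m * g t) * (M * g t - f t)" using fg[OF t] by simp
    then show "0 \<le> (- 1) * (f t)\<^sup>2 + (m + M) * (f t * g t) + (- (m * M)) * (g t)\<^sup>2"
      by (simp add: power2_eq_square algebra_simps)
  qed
  then show "X * Y - P\<^sup>2 \<le> 1 / 4 * (M - m)\<^sup>2 * Y\<^sup>2"
    using form[of 0 1] by (intro product_minus_square_le) simp_all
qed

text \<open>Here \<open>f\<close> equals \<open>m * g\<close> or \<open>M * g\<close> at each point,
  so the product of the two factors vanishes, and \<open>P = 0 = (m + M) / 2 * Y\<close>, so the
  discarded square vanishes too.\<close>

lemma admissible_two_point_sum:
  defines "T \<equiv> {0, 1 :: nat}"
  shows "admissible T (T \<rightarrow>\<^sub>E UNIV) (T \<rightarrow>\<^sub>E UNIV) (\<lambda>t\<in>T. if t = 0 then 1 else - 1)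
    (\<lambda>t\<in>T. 1) (\<lambda>t\<in>T. 1) (- 1) 1 (\<lambda>p. p 0 + p 1)"
  unfolding admissible_def function_algebra_def closed_add_def closed_scale_def closed_mult_def
    isotonic_linear_functional_def T_def
  by (auto simp: algebra_simps intro: add_mono)

(* HOL cannot quantify over types inside a formula. The bound is stated for T in an arbitrary
   type 'a. In the sharpness part T ranges over the nonempty subsets of nat: as this universal
   quantifier is negated, restricting it to one type yields the claim for all sets T. *)

theorem proposition1:
  "(\<forall>(T :: 'a set) F L f g h m M A. admissible T F L f g h m M A \<longrightarrow>
      0 \<le> A (\<lambda>t\<in>T. h t * (f t)\<^sup>2) * A (\<lambda>t\<in>T. h t * (g t)\<^sup>2) - (A (\<lambda>t\<in>T. h t * f t * g t))\<^sup>2 \<and>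
      A (\<lambda>t\<in>T. h t * (f t)\<^sup>2) * A (\<lambda>t\<in>T. h t * (g t)\<^sup>2) - (A (\<lambda>t\<in>T. h t * f t * g t))\<^sup>2
        \<le> 1 / 4 * (M - m)\<^sup>2 * (A (\<lambda>t\<in>T. h t * (g t)\<^sup>2))\<^sup>2)
   \<and>
   \<not> (\<exists>C < 1 / 4. \<forall>(T :: nat set) F L f g h m M A. admissible T F L f g h m M A \<longrightarrow>
      A (\<lambda>t\<in>T. h t * (f t)\<^sup>2) * A (\<lambda>t\<in>T. h t * (g t)\<^sup>2) - (A (\<lambda>t\<in>T. h t * f t * g t))\<^sup>2
        \<le> C * (M - m)\<^sup>2 * (A (\<lambda>t\<in>T. h t * (g t)\<^sup>2))\<^sup>2)"
proof (intro conjI)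
  show "\<forall>(T :: 'a set) F L f g h m M A. admissible T F L f g h m M A \<longrightarrow>
      0 \<le> A (\<lambda>t\<in>T. h t * (f t)\<^sup>2) * A (\<lambda>t\<in>T. h t * (g t)\<^sup>2) - (A (\<lambda>t\<in>T. h t * f t * g t))\<^sup>2 \<and>
      A (\<lambda>t\<in>T. h t * (f t)\<^sup>2) * A (\<lambda>t\<in>T. h t * (g t)\<^sup>2) - (A (\<lambda>t\<in>T. h t * f t * g t))\<^sup>2
        \<le> 1 / 4 * (M - m)\<^sup>2 * (A (\<lambda>t\<in>T. h t * (g t)\<^sup>2))\<^sup>2"
    using admissible_bounds by blast
next
  show "\<not> (\<exists>C < 1 / 4. \<forall>(T :: nat set) F L f g h m M A. admissible T F L f g h m M A \<longrightarrow>
      A (\<lambda>t\<in>T. h t * (f t)\<^sup>2) * A (\<lambda>t\<in>T. h t * (g t)\<^sup>2) - (A (\<lambda>t\<in>T. h t * f t * g t))\<^sup>2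
        \<le> C * (M - m)\<^sup>2 * (A (\<lambda>t\<in>T. h t * (g t)\<^sup>2))\<^sup>2)"
  proof clarify
    fix C :: real
    assume "C < 1 / 4" and bound: "\<forall>(T :: nat set) F L f g h m M A.
      admissible T F L f g h m M A \<longrightarrow>
      A (\<lambda>t\<in>T. h t * (f t)\<^sup>2) * A (\<lambda>t\<in>T. h t * (g t)\<^sup>2) - (A (\<lambda>t\<in>T. h t * f t * g t))\<^sup>2
        \<le> C * (M - m)\<^sup>2 * (A (\<lambda>t\<in>T. h t * (g t)\<^sup>2))\<^sup>2"
    \<comment> \<open>In the example \<open>X = Y = 2\<close>, \<open>P = 0\<close> and
      \<open>M - m = 2\<close>, so the bound reads \<open>4 \<le> 16 * C\<close>.\<close>
    then show False
      using bound[rule_format, OF admissible_two_point_sum] by simp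
  qed
qed

end
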